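(* Let $m,p \in \mathbb{N}$ with $p > m+1$, and define $A \coloneqq [0,m] \cup \{p\}$, where $[0,m]=\{0,1,\dots,m\}$. Then $A$ is a More Differences Than Sums (MDTS) set, i.e. $|A-A| > |A+A|$, and moreover $$ |A-A| - |A+A| \ = \ \begin{cases} m, & \text{if } p > 2m, \\ p - m - 1, & \text{if } m+1 < p \leq 2m. \end{cases} $$
   Context: For a finite set of integers $A$, $A+A=\{a+b: a,b\in A\}$ and $A-A=\{a-b: a,b\in A\}$; $|X|$ denotes cardinality. For integers $x\le y$, $[x,y]$ denotes the set of integers $\{x,x+1,\dots,y\}$. A finite set $A$ is MDTS if $|A-A|>|A+A|$. *)

theory Defs
  imports Main "HOL-Library.Set_Algebras"
begin

text \<open>
  The sumset of two sets is the \<open>+\<close> on sets from Set_Algebras. The difference set needs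
  a name of its own, since \<open>A - B\<close> on sets is the set-theoretic difference.
\<close>

definition diffset :: "int set \<Rightarrow> int set \<Rightarrow> int set" where
  "diffset A B = {a - b | a b. a \<in> A \<and> b \<in> B}"

definition MDTS :: "int set \<Rightarrow> bool" where
  "MDTS A \<longleftrightarrow> finite A \<and> card (diffset A A) > card (A + A)"

end

theory Submission imports Defs begin

text \<open>
  The sumset consists of the intervals \<open>[0, 2m]\<close> and \<open>[p, p + m]\<close> and the point \<open>2p\<close>; the
  difference set consists of \<open>[- m, m]\<close>, \<open>[p - m, p]\<close> and \<open>[- p, m - p]\<close>. For \<open>p > 2m\<close> the
  pieces are disjoint in both cases, giving \<open>3m + 3\<close> sums and \<open>4m + 3\<close> differences; for
  \<open>p \<le> 2m\<close> the intervals merge, giving \<open>p + m + 2\<close> sums and \<open>2p + 1\<close> differences.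
\<close>

text \<open>The pieces may overlap, so the formula serves both ranges of \<open>p\<close>.\<close>

lemma sumset_interval_insert:
  fixes m p :: int
  assumes "m \<ge> 0"
  shows "({0..m} \<union> {p}) + ({0..m} \<union> {p}) = {0..2 * m} \<union> {p..p + m} \<union> {2 * p}"
proof (intro subset_antisym subsetI)
  fix x assume "x \<in> ({0..m} \<union> {p}) + ({0..m} \<union> {p})"
  then show "x \<in> {0..2 * m} \<union> {p..p + m} \<union> {2 * p}"
    by (auto elim!: set_plus_elim)
next
  fix x assume "x \<in> {0..2 * m} \<union> {p..p + m} \<union> {2 * p}"
  then consider "0 \<le> x" "x \<le> 2 * m" | "p \<le> x" "x \<le> p + m" | "x = 2 * p"
    by auto
  then show "x \<in> ({0..m} \<union> {p}) + ({0..m} \<union> {p})"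
  proof cases
    case 1
    \<comment> \<open>Greedy split: the first summand is as large as \<open>m\<close> allows, and
      \<open>x \<le> 2 * m\<close> keeps the rest at most \<open>m\<close>.\<close>
    then show ?thesis
      using set_plus_intro[of "min x m" "{0..m} \<union> {p}" "x - min x m" "{0..m} \<union> {p}"] assms
      by (simp add: min_def split: if_splits)
  next
    case 2
    then show ?thesis
      using set_plus_intro[of p "{0..m} \<union> {p}" "x - p" "{0..m} \<union> {p}"] by simp
  next
    case 3
    then show ?thesis
      using set_plus_intro[of p "{0..m} \<union> {p}" p "{0..m} \<union> {p}"] by simp
  qed
qed

lemma diffset_intro: "a \<in> A \<Longrightarrow> b \<in> B \<Longrightarrow> a - b \<in> diffset A B"
  by (auto simp: diffset_def)

lemma diffset_interval_insert:
  fixes m p :: int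
  assumes "m \<ge> 0"
  shows "diffset ({0..m} \<union> {p}) ({0..m} \<union> {p}) = {- m..m} \<union> {p - m..p} \<union> {- p..m - p}"
proof (intro subset_antisym subsetI)
  fix x assume "x \<in> diffset ({0..m} \<union> {p}) ({0..m} \<union> {p})"
  then show "x \<in> {- m..m} \<union> {p - m..p} \<union> {- p..m - p}"
    using assms by (auto simp: diffset_def)
next
  fix x assume "x \<in> {- m..m} \<union> {p - m..p} \<union> {- p..m - p}"
  \<comment> \<open>The middle interval is split by sign: \<open>x\<close> is \<open>x - 0\<close>
    or \<open>0 - (- x)\<close>.\<close>
  then consider "0 \<le> x" "x \<le> m" | "- m \<le> x" "x < 0" | "p - m \<le> x" "x \<le> p" | "- p \<le> x" "x \<le> m - p"
    by fastforce
  then show "x \<in> diffset ({0..m} \<union> {p}) ({0..m} \<union> {p})"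
  proof cases
    case 1
    then show ?thesis
      using diffset_intro[of x "{0..m} \<union> {p}" 0 "{0..m} \<union> {p}"] assms by simp
  next
    case 2
    then show ?thesis
      using diffset_intro[of 0 "{0..m} \<union> {p}" "- x" "{0..m} \<union> {p}"] assms by simp
  next
    case 3
    then show ?thesis
      using diffset_intro[of p "{0..m} \<union> {p}" "p - x" "{0..m} \<union> {p}"] by simp
  next
    case 4
    then show ?thesis
      using diffset_intro[of "x + p" "{0..m} \<union> {p}" p "{0..m} \<union> {p}"] by simp
  qed
qed

theorem theorem2p4:
  fixes m p :: nat and A :: "int set"
  assumes "m \<ge> 1" and "p > m + 1"
    and "A = {0..int m} \<union> {int p}"
  shows "MDTS A \<and>
    int (card (diffset A A)) - int (card (A + A)) =
      (if p > 2 * m then int m else int p - int m - 1)"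
proof -
  define M P where "M = int m" and "P = int p"
  have M: "M \<ge> 1" and P: "P > M + 1"
    using assms(1,2) by (simp_all add: M_def P_def)
  have A: "A = {0..M} \<union> {P}"
    using assms(3) by (simp add: M_def P_def)
  have sums: "A + A = {0..2 * M} \<union> {P..P + M} \<union> {2 * P}"
    unfolding A using M by (intro sumset_interval_insert) simp
  have diffs: "diffset A A = {- M..M} \<union> {P - M..P} \<union> {- P..M - P}"
    unfolding A using M by (intro diffset_interval_insert) simp
  have card_diff: "int (card (diffset A A)) - int (card (A + A))
      = (if P > 2 * M then M else P - M - 1)"
  proof (cases "P > 2 * M")
    case True
    have "card (A + A) = card {0..2 * M} + card {P..P + M} + card {2 * P}"
      unfolding sums using True M P by (subst card_Un_disjoint; simp add: card_Un_disjoint)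
    \<comment> \<open>\<open>P > 2 * M\<close> gives \<open>M < P - M\<close> and, by symmetry,
      \<open>M - P < - M\<close>.\<close>
    moreover have "card (diffset A A) = card {- M..M} + card {P - M..P} + card {- P..M - P}"
      unfolding diffs using True M P by (subst card_Un_disjoint; auto simp: card_Un_disjoint)
    ultimately show ?thesis
      using True M by simp
  next
    case False
    \<comment> \<open>The intervals meet as \<open>P \<le> 2 * M\<close>; \<open>2 * P\<close> stays
      outside because \<open>M < P\<close>.\<close>
    have "A + A = insert (2 * P) {0..P + M}"
      unfolding sums using False M P by auto
    then have "card (A + A) = Suc (card {0..P + M})"
      using P by simp
    \<comment> \<open>Here \<open>P - M \<le> M\<close>, so both outer intervals meet the middle
      one.\<close>
    moreover have "diffset A A = {- P..P}"
      unfolding diffs using False M P by auto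
    ultimately show ?thesis
      using False M P by simp
  qed
  moreover have "finite A"
    by (simp add: A)
  \<comment> \<open>Both values of the gap are positive: \<open>M \<ge> 1\<close> and
    \<open>P > M + 1\<close>.\<close>
  ultimately show ?thesis
    using M P by (auto simp: MDTS_def M_def P_def split: if_splits)
qed

end
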